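(* Let $T_S:A_S^{\mathbb Z}\to A_S^{\mathbb Z}$ be the cellular automaton defined in the context. Then $(A_S^{\mathbb Z},T_S)$ is neither diam-mean sensitive nor almost diam-mean equicontinuous.
   Context: $\mathbb N$ includes $0$. For a finite alphabet $A$, the full shift $A^{\mathbb Z}$ carries the metric $d(x,y)=2^{-i}$ with $i=\min\{|j|:x_j\ne y_j\}$ if $x\neq y$, and $d(x,x)=0$. $B_\delta(x)=\{y: d(x,y)<\delta\}$ and $\operatorname{diam}$ denotes diameter. A cellular automaton is a continuous map of a full shift to itself commuting with the shift $\sigma(x)_i=x_{i+1}$. For a compact metric space $X$ and continuous $T:X\to X$: $x\in X$ is a diam-mean equicontinuity point if for every $\varepsilon>0$ there is $\delta>0$ with $\limsup_{n\to\infty}\frac1{n+1}\sum_{i=0}^n\operatorname{diam}(T^iB_\delta(x))<\varepsilon$. $(X,T)$ is almost diam-mean equicontinuous if the set of diam-mean equicontinuity points is residual, i.e. contains a countable intersection of dense open sets. $(X,T)$ is diam-mean sensitive if there is $\varepsilon>0$ such that for every non-empty open $U\subseteq X$, $\limsup_{n\to\infty}\frac1n\sum_{i=1}^n\operatorname{diam}(T^iU)>\varepsilon$. The automaton $T$. Let $A_1=\{\square,0,1,2\}$, where $\square$ is a blank symbol, and define $T_1:A_1^{\mathbb Z}\to A_1^{\mathbb Z}$ by: $(T_1x)_i=\square$ if $x_i=\square$; if $x_i\ne\square$, then $(T_1x)_i=x_i+1 \bmod 3$ if $x_{i+1}\in\{\square,2\}$ and $(T_1x)_i=x_i$ otherwise.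 Let $A_2=\{\square,\leftarrow\}$, $A=A_1\times A_2$, and let $\gamma_1,\gamma_2$ be the coordinatewise projections of $A^{\mathbb Z}$ to $A_1^{\mathbb Z},A_2^{\mathbb Z}$. $T:A^{\mathbb Z}\to A^{\mathbb Z}$ is given by $\gamma_1(Tx)=T_1(\gamma_1(x))$ and: $\gamma_2(Tx)_i=\leftarrow$ if and only if either [$\gamma_2(x)_{i+1}=\leftarrow$ and $\gamma_1(x)_{i+1}\in\{\square,2\}$] or [$\gamma_2(x)_i=\leftarrow$ and $\gamma_1(x)_i\in\{0,1\}$]; otherwise $\gamma_2(Tx)_i=\square$. The automaton $T_S$. Let $A_3=\{a,b,c\}$ and let $\tau:A_3\to A_3$ fix $a$ and exchange $b$ and $c$. Let $A_S=A\times A_3$; for $x\in A_S^{\mathbb Z}$ write $x^1\in A^{\mathbb Z}$, $x^2\in A_3^{\mathbb Z}$ for its components. Then $(T_Sx)_i=((Tx^1)_i,\,x^2_i)$ if $\gamma_2(x^1)_i=\leftarrow$, and $(T_Sx)_i=((Tx^1)_i,\,\tau(x^2_i))$ otherwise. *)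

theory Defs
  imports "HOL-Analysis.Analysis"
begin

section \<open>Full shifts as metric spaces\<close>

text \<open>A separate type is needed because the function type already carries the product metric of
  \<^theory>\<open>HOL-Analysis.Function_Metric\<close>, which is not the one used here.\<close>

typedef 'a config = "UNIV :: (int \<Rightarrow> 'a) set"
  morphisms cell Config ..

lemma cell_Config [simp]: "cell (Config f) = f"
  by (simp add: Config_inverse)

lemma config_eqI: "(\<And>i. cell x i = cell y i) \<Longrightarrow> x = y"
  by (metis cell_inject ext)

instantiation config :: (type) metric_space
begin

definition dist_config :: "'a config \<Rightarrow> 'a config \<Rightarrow> real" where
  "dist_config x y = (if x = y then 0 else (1/2) ^ Inf {nat \<bar>j\<bar> | j. cell x j \<noteq> cell y j})"

definition uniformity_config :: "('a config \<times> 'a config) filter" where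
  "uniformity_config = (INF e\<in>{0<..}. principal {(x, y). dist x y < e})"

definition open_config :: "'a config set \<Rightarrow> bool" where
  "open_config U = (\<forall>x\<in>U. eventually (\<lambda>(x', y). x' = x \<longrightarrow> y \<in> U) uniformity)"

lemma dist_config_less_iff:
  fixes x y :: "'a config"
  shows "dist x y < (1/2) ^ n \<longleftrightarrow> (\<forall>j. \<bar>j\<bar> \<le> int n \<longrightarrow> cell x j = cell y j)"
proof (cases "x = y")
  case False
  define D where "D = {nat \<bar>j\<bar> | j. cell x j \<noteq> cell y j}"
  have "D \<noteq> {}"
    using False config_eqI[of x y] by (auto simp: D_def)
  hence mem: "Inf D \<in> D"
    by (rule Inf_nat_def1)
  have "dist x y < (1/2) ^ n \<longleftrightarrow> n < Inf D"
    using False by (simp add: dist_config_def D_def power_strict_decreasing_iff)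
  also have "\<dots> \<longleftrightarrow> (\<forall>d\<in>D. n < d)"
    using mem by (meson cInf_lower bdd_below_bot less_le_trans)
  also have "\<dots> \<longleftrightarrow> (\<forall>j. \<bar>j\<bar> \<le> int n \<longrightarrow> cell x j = cell y j)"
    unfolding D_def by (auto simp: not_le[symmetric] nat_le_iff)
  finally show ?thesis .
qed (simp add: dist_config_def)

instance
proof
  fix x y z :: "'a config"
  show "uniformity = (INF e\<in>{0<..}. principal {(x, y). dist (x :: 'a config) y < e})"
    by (rule uniformity_config_def)
  show "open U = (\<forall>x\<in>U. eventually (\<lambda>(x', y). x' = x \<longrightarrow> y \<in> U) uniformity)"
    for U :: "'a config set"
    by (rule open_config_def)
  show "dist x y = 0 \<longleftrightarrow> x = y"
    by (simp add: dist_config_def)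
  show "dist x y \<le> dist x z + dist y z"
  proof (rule ccontr)
    assume *: "\<not> ?thesis"
    have nonneg: "dist u v \<ge> 0" for u v :: "'a config"
      by (simp add: dist_config_def)
    have "x \<noteq> y"
      using * nonneg[of x z] nonneg[of y z] by (auto simp: dist_config_def)
    then obtain n where n: "dist x y = (1/2) ^ n"
      by (auto simp: dist_config_def)
    have "dist x z < (1/2) ^ n" "dist y z < (1/2) ^ n"
      using * n nonneg[of x z] nonneg[of y z] by linarith+
    hence "dist x y < (1/2) ^ n"
      by (simp add: dist_config_less_iff)
    with n show False by simp
  qed
qed

end

definition shift :: "'a config \<Rightarrow> 'a config" where
  "shift x = Config (\<lambda>i. cell x (i + 1))"

definition cellular_automaton :: "('a config \<Rightarrow> 'a config) \<Rightarrow> bool" where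
  "cellular_automaton F \<longleftrightarrow> continuous_on UNIV F \<and> F \<circ> shift = shift \<circ> F"

lemma compact_full_shift: "compact (UNIV :: 'a::finite config set)"
proof -
  let ?P = "product_topology (\<lambda>_::int. discrete_topology (UNIV :: 'a set)) UNIV"
  have "openin ?P {f. Config f \<in> U}" if "open U" for U :: "'a config set"
  proof (subst openin_subopen, intro ballI)
    fix f assume "f \<in> {f. Config f \<in> U}"
    with \<open>open U\<close> obtain e where e: "e > 0" "\<And>y. dist (Config f) y < e \<Longrightarrow> y \<in> U"
      by (metis mem_Collect_eq open_contains_ball_eq subsetD mem_ball)
    obtain n where n: "(1/2 :: real) ^ n < e"
      using real_arch_pow_inv[of e "1/2"] e by auto
    let ?X = "\<lambda>j. if \<bar>j\<bar> \<le> int n then {f j} else UNIV"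
    have "{j. ?X j \<noteq> UNIV} \<subseteq> {- int n..int n}"
      by auto
    hence "finite {j. ?X j \<noteq> UNIV}"
      by (rule finite_subset) simp
    hence "openin ?P (Pi\<^sub>E UNIV ?X)"
      by (intro product_topology_basis) auto
    moreover have "f \<in> Pi\<^sub>E UNIV ?X"
      by auto
    moreover have "Pi\<^sub>E UNIV ?X \<subseteq> {f. Config f \<in> U}"
    proof
      fix g assume g: "g \<in> Pi\<^sub>E UNIV ?X"
      have "g j = f j" if "\<bar>j\<bar> \<le> int n" for j
        using PiE_mem[OF g, of j] that by auto
      hence "dist (Config f) (Config g) < (1/2) ^ n"
        by (simp add: dist_config_less_iff)
      with n e show "g \<in> {f. Config f \<in> U}" by auto
    qed
    ultimately show "\<exists>W. openin ?P W \<and> f \<in> W \<and> W \<subseteq> {f. Config f \<in> U}"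
      by blast
  qed
  hence "continuous_map ?P euclidean Config"
    by (simp add: continuous_map_def)
  moreover have "compact_space ?P"
    by (simp add: compact_space_product_topology compact_space_discrete_topology)
  ultimately have "compactin euclidean (Config ` topspace ?P)"
    by (metis image_compactin compact_space_def)
  moreover have "Config ` topspace ?P = UNIV"
    by (auto intro: range_eqI[of _ _ "cell _"] simp: cell_inverse)
  ultimately show ?thesis
    by simp
qed

text \<open>A map whose output at a cell depends only on the cell and its right neighbour, through
  the same rule everywhere, is a cellular automaton.\<close>

lemma cellular_automaton_local_rule:
  assumes F: "\<And>x i. cell (F x) i = r (cell x i) (cell x (i + 1))"
  shows "cellular_automaton F"
  unfolding cellular_automaton_def
proof
  show "F \<circ> shift = shift \<circ> F"
    by (auto intro!: config_eqI simp: F shift_def)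
  show "continuous_on UNIV F"
  proof (clarsimp simp: continuous_on_iff)
    fix x :: "'a config" and e :: real
    assume "e > 0"
    then obtain n where n: "(1/2 :: real) ^ n < e"
      using real_arch_pow_inv[of e "1/2"] by auto
    have "dist (F y) (F x) < e" if "dist y x < (1/2) ^ Suc n" for y
    proof -
      have "cell y j = cell x j" if "\<bar>j\<bar> \<le> int (Suc n)" for j
        using \<open>dist y x < (1/2) ^ Suc n\<close> that unfolding dist_config_less_iff by blast
      hence "dist (F y) (F x) < (1/2) ^ n"
        unfolding dist_config_less_iff F by (simp add: abs_le_iff)
      with n show ?thesis by simp
    qed
    thus "\<exists>d>0. \<forall>y. dist y x < d \<longrightarrow> dist (F y) (F x) < e"
      by (intro exI[of _ "(1/2) ^ Suc n"]) auto
  qed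
qed


section \<open>Diam-mean equicontinuity and sensitivity\<close>

text \<open>The phase space is the whole type; it is meant to be compact and the map continuous.\<close>

definition diam_mean_equicontinuity_point ::
    "('a::metric_space \<Rightarrow> 'a) \<Rightarrow> 'a \<Rightarrow> bool" where
  "diam_mean_equicontinuity_point T x \<longleftrightarrow>
     (\<forall>\<epsilon>>0. \<exists>\<delta>>0.
        limsup (\<lambda>n. ereal ((\<Sum>i=0..n. diameter ((T ^^ i) ` ball x \<delta>)) / (real n + 1))) < ereal \<epsilon>)"

definition residual :: "'a::topological_space set \<Rightarrow> bool" where
  "residual S \<longleftrightarrow>
     (\<exists>\<G>. countable \<G> \<and> (\<forall>U\<in>\<G>. open U \<and> closure U = UNIV) \<and> \<Inter>\<G> \<subseteq> S)"

definition almost_diam_mean_equicontinuous :: "('a::metric_space \<Rightarrow> 'a) \<Rightarrow> bool" where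
  "almost_diam_mean_equicontinuous T \<longleftrightarrow> residual {x. diam_mean_equicontinuity_point T x}"

definition diam_mean_sensitive :: "('a::metric_space \<Rightarrow> 'a) \<Rightarrow> bool" where
  "diam_mean_sensitive T \<longleftrightarrow>
     (\<exists>\<epsilon>>0. \<forall>U. open U \<and> U \<noteq> {} \<longrightarrow>
        limsup (\<lambda>n. ereal ((\<Sum>i=1..n. diameter ((T ^^ i) ` U)) / real n)) > ereal \<epsilon>)"


section \<open>The automaton\<close>

datatype A1 = Blank1 | D0 | D1 | D2
datatype A2 = Blank2 | Arrow
datatype A3 = SymA | SymB | SymC

type_synonym A = "A1 \<times> A2"
type_synonym AS = "A \<times> A3"

instance A1 :: finite
proof
  have "(UNIV :: A1 set) \<subseteq> {Blank1, D0, D1, D2}"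
    using A1.exhaust by blast
  thus "finite (UNIV :: A1 set)" by (rule finite_subset) simp
qed

instance A2 :: finite
proof
  have "(UNIV :: A2 set) \<subseteq> {Blank2, Arrow}"
    using A2.exhaust by blast
  thus "finite (UNIV :: A2 set)" by (rule finite_subset) simp
qed

instance A3 :: finite
proof
  have "(UNIV :: A3 set) \<subseteq> {SymA, SymB, SymC}"
    using A3.exhaust by blast
  thus "finite (UNIV :: A3 set)" by (rule finite_subset) simp
qed

text \<open>Addition of 1 modulo 3 on the digits; its value at the blank is never used.\<close>

fun incr :: "A1 \<Rightarrow> A1" where
  "incr D0 = D1"
| "incr D1 = D2"
| "incr D2 = D0"
| "incr Blank1 = Blank1"

definition T1 :: "A1 config \<Rightarrow> A1 config" where
  "T1 x = Config (\<lambda>i.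
     if cell x i = Blank1 then Blank1
     else if cell x (i + 1) \<in> {Blank1, D2} then incr (cell x i)
     else cell x i)"

definition \<gamma>1 :: "A config \<Rightarrow> A1 config" where
  "\<gamma>1 x = Config (\<lambda>i. fst (cell x i))"

definition \<gamma>2 :: "A config \<Rightarrow> A2 config" where
  "\<gamma>2 x = Config (\<lambda>i. snd (cell x i))"

definition T :: "A config \<Rightarrow> A config" where
  "T x = Config (\<lambda>i.
     (cell (T1 (\<gamma>1 x)) i,
      if (cell (\<gamma>2 x) (i + 1) = Arrow \<and> cell (\<gamma>1 x) (i + 1) \<in> {Blank1, D2})
       \<or> (cell (\<gamma>2 x) i = Arrow \<and> cell (\<gamma>1 x) i \<in> {D0, D1})
      then Arrow else Blank2))"

fun \<tau> :: "A3 \<Rightarrow> A3" where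
  "\<tau> SymA = SymA"
| "\<tau> SymB = SymC"
| "\<tau> SymC = SymB"

definition comp1 :: "AS config \<Rightarrow> A config" where
  "comp1 x = Config (\<lambda>i. fst (cell x i))"

definition comp2 :: "AS config \<Rightarrow> A3 config" where
  "comp2 x = Config (\<lambda>i. snd (cell x i))"

definition T_S :: "AS config \<Rightarrow> AS config" where
  "T_S x = Config (\<lambda>i.
     (cell (T (comp1 x)) i,
      if cell (\<gamma>2 (comp1 x)) i = Arrow then cell (comp2 x) i else \<tau> (cell (comp2 x) i)))"

lemma cellular_automaton_T_S: "cellular_automaton T_S"
proof (rule cellular_automaton_local_rule)
  fix x i
  show "cell (T_S x) i =
    (\<lambda>((p, q), s) ((p', q'), _).
       ((if p = Blank1 then Blank1 else if p' \<in> {Blank1, D2} then incr p else p,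
         if q' = Arrow \<and> p' \<in> {Blank1, D2} \<or> q = Arrow \<and> p \<in> {D0, D1} then Arrow else Blank2),
        if q = Arrow then s else \<tau> s)) (cell x i) (cell x (i + 1))"
    by (simp add: T_S_def T_def T1_def \<gamma>1_def \<gamma>2_def comp1_def comp2_def split_beta)
qed

end

theory Submission
  imports Defs
begin

text \<open>
  Say that a cell is free if its digit is blank or 2: free cells let an arrow through and make the
  digit to their left advance. A block of \<^term>\<open>2 ^ i - 1\<close> zeros to the left of a blank is an odometer
  of period \<^term>\<open>3 ^ i\<close> whose leftmost cell is free only once per period, so it lets through at most
  one arrow per period. Hence a window of blanks carrying the symbol \<^term>\<open>SymA\<close>, shielded by such
  a block, changes with arbitrarily small density, and \<^term>\<open>T_S\<close> is not diam-mean sensitive.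

  On the other hand, let \<^term>\<open>x\<close> have a blank and the symbol \<^term>\<open>SymB\<close> at the origin. Replace
  \<^term>\<open>x\<close> far from the origin by blanks without arrows; then every arrow eventually leaves the
  right half-line. One additional arrow, placed far enough to the right, meets no other arrow on
  \<open>[0, \<infinity>)\<close> when it arrives and spends exactly one time step at the origin; from then on the symbols
  at the origin disagree. So no such \<^term>\<open>x\<close> is a diam-mean equicontinuity point.
\<close>

section \<open>Diameters in full shifts\<close>

lemma dist_config_le_1: "dist x y \<le> (1::real)" for x y :: "'a config"
  by (simp add: dist_config_def power_le_one)

lemma bounded_config: "bounded (S :: 'a config set)"
  unfolding bounded_def using dist_config_le_1 by blast

lemma dist_le_diameter_config: "x \<in> S \<Longrightarrow> y \<in> S \<Longrightarrow> dist x y \<le> diameter S" for x y :: "'a config"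
  by (rule diameter_bounded_bound[OF bounded_config])

lemma diameter_config_le:
  fixes S :: "'a config set"
  assumes "0 \<le> d" "\<And>x y. x \<in> S \<Longrightarrow> y \<in> S \<Longrightarrow> dist x y \<le> d"
  shows "diameter S \<le> d"
  using assms by (auto simp: diameter_def intro!: cSUP_least)

lemma mem_ball_config:
  "y \<in> ball x ((1/2) ^ n) \<longleftrightarrow> (\<forall>j. \<bar>j\<bar> \<le> int n \<longrightarrow> cell y j = cell x j)"
  for x y :: "'a config"
  unfolding mem_ball dist_config_less_iff by auto

text \<open>Baire's theorem, available because the full shift is compact: residuality is refuted by
  a single non-empty open set that \<open>S\<close> misses.\<close>

lemma residual_dense:
  fixes S :: "'a::finite config set"
  assumes "residual S" "open U" "U \<noteq> {}"
  shows "S \<inter> U \<noteq> {}"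
proof -
  obtain \<G> where \<G>: "countable \<G>" "\<And>G. G \<in> \<G> \<Longrightarrow> open G \<and> closure G = UNIV" "\<Inter>\<G> \<subseteq> S"
    using assms(1) unfolding residual_def by blast
  have "compact_space (euclidean :: 'a config topology)"
    by (simp add: compact_space_def compact_full_shift)
  hence "locally_compact_space (euclidean :: 'a config topology)"
    by (rule compact_imp_locally_compact_space)
  moreover have "regular_space (euclidean :: 'a config topology)"
    using metrizable_imp_regular_space metrizable_space_euclidean by blast
  ultimately have "closure (\<Inter>\<G>) = UNIV"
    using Baire_category[of euclidean \<G>] \<G> by simp
  with assms \<G>(3) show ?thesis
    by (metis Int_commute closure_mono open_Int_closure_eq_empty inf_top_right
        top.extremum_uniqueI)
qed


section \<open>The local rules\<close>

definition digit :: "AS config \<Rightarrow> int \<Rightarrow> A1" where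
  "digit x i = fst (fst (cell x i))"

definition arrow :: "AS config \<Rightarrow> int \<Rightarrow> bool" where
  "arrow x i \<longleftrightarrow> snd (fst (cell x i)) = Arrow"

definition symbol :: "AS config \<Rightarrow> int \<Rightarrow> A3" where
  "symbol x i = snd (cell x i)"

definition free :: "AS config \<Rightarrow> int \<Rightarrow> bool" where
  "free x i \<longleftrightarrow> digit x i \<in> {Blank1, D2}"

lemma cell_eqI:
  assumes "digit x i = digit y i" "arrow x i = arrow y i" "symbol x i = symbol y i"
  shows "cell x i = cell y i"
proof -
  have "snd (fst (cell x i)) = snd (fst (cell y i))"
    using assms(2) unfolding arrow_def
    by (cases "snd (fst (cell x i))"; cases "snd (fst (cell y i))") simp_all
  with assms(1,3) show ?thesis
    by (simp add: prod_eq_iff digit_def symbol_def)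
qed

lemma digit_T_S:
  "digit (T_S x) i = (if digit x i \<noteq> Blank1 \<and> free x (i + 1) then incr (digit x i) else digit x i)"
  by (simp add: digit_def free_def T_S_def T_def T1_def \<gamma>1_def comp1_def)

text \<open>\<open>{D0, D1}\<close> is the complement of the free digits, so an arrow steps left
  exactly when its cell is free and waits otherwise.\<close>

lemma arrow_T_S:
  "arrow (T_S x) i \<longleftrightarrow> arrow x (i + 1) \<and> free x (i + 1) \<or> arrow x i \<and> \<not> free x i"
  by (cases "fst (fst (cell x i))")
    (simp_all add: arrow_def digit_def free_def T_S_def T_def T1_def \<gamma>1_def \<gamma>2_def comp1_def)

lemma symbol_T_S: "symbol (T_S x) i = (if arrow x i then symbol x i else \<tau> (symbol x i))"
  by (simp add: symbol_def arrow_def T_S_def \<gamma>2_def comp1_def comp2_def)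

lemma digit_Blank1_iff [simp]: "digit ((T_S ^^ t) x) i = Blank1 \<longleftrightarrow> digit x i = Blank1"
proof (induction t)
  case (Suc t)
  thus ?case
    by (cases "digit ((T_S ^^ t) x) i") (auto simp: digit_T_S)
qed simp

lemma free_Blank1: "digit x i = Blank1 \<Longrightarrow> free ((T_S ^^ t) x) i"
  by (simp add: free_def)

lemma digit_constant:
  assumes "\<And>s. s < t \<Longrightarrow> \<not> free ((T_S ^^ s) x) (i + 1)"
  shows "digit ((T_S ^^ t) x) i = digit x i"
  using assms by (induction t) (simp_all add: digit_T_S)


section \<open>The odometer\<close>

text \<open>The strict bound leaves \<open>k - 1\<close> zeros. Two such blocks joined by one more
  zero thus form a block for \<open>2 * k\<close>, which suits an induction over
  \<open>k = 2 ^ i\<close>.\<close>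

definition zeros :: "AS config \<Rightarrow> int \<Rightarrow> nat \<Rightarrow> bool" where
  "zeros x R k \<longleftrightarrow> (\<forall>j. 1 \<le> j \<and> j < int k \<longrightarrow> digit x (R - j) = D0)"

text \<open>A digit advances only beside a free cell. In the block each right neighbour is another
  zero or \<open>R\<close> itself, so nothing moves until \<open>R\<close> is free.\<close>

lemma zeros_blocked:
  assumes "zeros x R k" "\<And>s. s < t \<Longrightarrow> \<not> free ((T_S ^^ s) x) R"
  shows "zeros ((T_S ^^ t) x) R k"
  using assms(2)
proof (induction t)
  case 0
  show ?case using assms(1) by simp
next
  case (Suc t)
  hence IH: "zeros ((T_S ^^ t) x) R k" and nf: "\<not> free ((T_S ^^ t) x) R"
    by auto
  have "digit ((T_S ^^ Suc t) x) (R - j) = D0" if j: "1 \<le> j" "j < int k" for j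
  proof -
    have "\<not> free ((T_S ^^ t) x) (R - j + 1)"
    proof (cases "j = 1")
      case False
      hence "digit ((T_S ^^ t) x) (R - (j - 1)) = D0"
        using IH j unfolding zeros_def by auto
      thus ?thesis by (simp add: free_def algebra_simps)
    qed (use nf in simp)
    thus ?thesis
      using IH j by (simp add: digit_T_S zeros_def)
  qed
  thus ?case by (simp add: zeros_def)
qed

lemma digit_after_period:
  assumes "0 < P" "\<And>t. t < P \<Longrightarrow> free ((T_S ^^ t) x) (i + 1) \<longleftrightarrow> t = P - 1"
    and "digit x i \<noteq> Blank1"
  shows "t < P \<Longrightarrow> digit ((T_S ^^ t) x) i = digit x i"
    and "digit ((T_S ^^ P) x) i = incr (digit x i)"
proof -
  show *: "digit ((T_S ^^ t) x) i = digit x i" if "t < P" for t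
    using assms(2) that by (intro digit_constant) auto
  obtain p where "P = Suc p"
    using \<open>0 < P\<close> gr0_conv_Suc by blast
  with assms *[of p] show "digit ((T_S ^^ P) x) i = incr (digit x i)"
    by (simp add: digit_T_S)
qed

text \<open>In the induction step, three periods of the block of length \<^term>\<open>2 ^ i - 1\<close> on the right take
  the next digit through 0, 1, 2, and during the last of them this digit plays the role of the
  blank for a second such block.\<close>

lemma odometer:
  assumes "\<And>t. t < 3 ^ i \<Longrightarrow> free ((T_S ^^ t) x) R" "zeros x R (2 ^ i)"
  shows "zeros ((T_S ^^ (3 ^ i)) x) R (2 ^ i) \<and>
    (\<forall>t < 3 ^ i. free ((T_S ^^ t) x) (R - (2 ^ i - 1)) \<longleftrightarrow> t = 3 ^ i - 1)"
  using assms
proof (induction i arbitrary: x R)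
  case 0
  thus ?case by (auto simp: zeros_def)
next
  case (Suc i)
  define P :: nat where "P = 3 ^ i"
  define K :: nat where "K = 2 ^ i"
  \<comment> \<open>The middle cell: \<open>2 * K - 1\<close> zeros split into \<open>K - 1\<close>
    zeros, \<open>M\<close>, and \<open>K - 1\<close> zeros.\<close>
  define M where "M = R - int K"
  have P: "P > 0" and K: "K \<ge> 1"
    by (simp_all add: P_def K_def)
  have fr: "free ((T_S ^^ t) x) R" if "t < 3 * P" for t
    using Suc.prems(1)[of t] that by (simp add: P_def)
  have z0: "zeros x R K"
    using Suc.prems(2) by (auto simp: zeros_def K_def)
  have digM: "digit x M = D0"
    using Suc.prems(2) K unfolding zeros_def M_def K_def by auto
  have zM: "zeros x M K"
    unfolding zeros_def
  proof (intro allI impI)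
    fix j assume "1 \<le> j \<and> j < int K"
    thus "digit x (M - j) = D0"
      using Suc.prems(2)[unfolded zeros_def, rule_format, of "int K + j"]
      by (simp add: M_def K_def algebra_simps)
  qed
  \<comment> \<open>The induction hypothesis for the right block, whose leftmost cell is
    \<open>M + 1\<close>: the digit at \<open>M\<close> advances once per period, in its last
    step.\<close>
  have step: "zeros ((T_S ^^ P) y) R K"
      "\<And>t. t < P \<Longrightarrow> free ((T_S ^^ t) y) (M + 1) \<longleftrightarrow> t = P - 1"
    if "zeros y R K" "\<And>t. t < P \<Longrightarrow> free ((T_S ^^ t) y) R" for y
    using Suc.IH[of y R] that by (auto simp: P_def K_def M_def algebra_simps)
  define y where "y = (T_S ^^ P) x"
  define z where "z = (T_S ^^ P) y"
  have y_iter: "(T_S ^^ t) y = (T_S ^^ (t + P)) x" for t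
    by (simp add: y_def funpow_add)
  have z_iter: "(T_S ^^ t) z = (T_S ^^ (t + 2 * P)) x" for t
    by (simp add: z_def y_def funpow_add mult_2)
  have fy: "free ((T_S ^^ t) y) R" and fz: "free ((T_S ^^ t) z) R" if "t < P" for t
    unfolding y_iter z_iter using that by (auto intro!: fr)
  have fx: "free ((T_S ^^ t) x) R" if "t < P" for t
    using that by (intro fr) simp
  have zy: "zeros y R K"
    unfolding y_def by (rule step(1)[OF z0 fx])
  have zz: "zeros z R K"
    unfolding z_def by (rule step(1)[OF zy fy])
  have zend: "zeros ((T_S ^^ P) z) R K"
    by (rule step(1)[OF zz fz])
  note dx = digit_after_period[OF P step(2)[OF z0 fx], unfolded digM, simplified]
  have dy0: "digit y M = D1"
    using dx(2) by (simp add: y_def)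
  note dy = digit_after_period[OF P step(2)[OF zy fy], unfolded dy0, simplified]
  have dz0: "digit z M = D2"
    using dy(2) by (simp add: z_def)
  note dz = digit_after_period[OF P step(2)[OF zz fz], unfolded dz0, simplified]
  \<comment> \<open>The digit at \<open>M\<close> is 0 in the first period and 1 in the second,
    which keeps the left block frozen.\<close>
  have blocked: "\<not> free ((T_S ^^ t) x) M" if "t < 2 * P" for t
  proof (cases "t < P")
    case True
    thus ?thesis using dx(1) by (simp add: free_def)
  next
    case False
    hence "(T_S ^^ t) x = (T_S ^^ (t - P)) y"
      by (simp add: y_iter)
    thus ?thesis using dy(1)[of "t - P"] that False by (simp add: free_def)
  qed
  have zeroM: "zeros ((T_S ^^ t) x) M K" if "t \<le> 2 * P" for t
    using that by (intro zeros_blocked zM blocked) auto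
  have zMz: "zeros z M K"
    using zeroM[of "2 * P"] z_iter[of 0] by simp
  have fMz: "free ((T_S ^^ t) z) M" if "t < P" for t
    using dz(1)[OF that] by (simp add: free_def)
  \<comment> \<open>The induction hypothesis again, now with \<open>M\<close> as right end.\<close>
  have top: "zeros ((T_S ^^ P) z) M K"
      "\<And>t. t < P \<Longrightarrow> free ((T_S ^^ t) z) (M - (int K - 1)) \<longleftrightarrow> t = P - 1"
    using Suc.IH[of z M] fMz zMz by (auto simp: P_def K_def)
  have end_iter: "(T_S ^^ (3 ^ Suc i)) x = (T_S ^^ P) z"
    by (simp add: z_iter P_def)
  have "zeros ((T_S ^^ P) z) R (2 ^ Suc i)"
    unfolding zeros_def
  proof (intro allI impI)
    fix j assume j: "1 \<le> j \<and> j < int (2 ^ Suc i)"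
    consider "j < int K" | "j = int K" | "j > int K" by linarith
    thus "digit ((T_S ^^ P) z) (R - j) = D0"
    proof cases
      case 1
      thus ?thesis using zend j by (simp add: zeros_def)
    next
      case 2
      thus ?thesis using dz(2) by (simp add: M_def)
    next
      case 3
      hence "digit ((T_S ^^ P) z) (M - (j - int K)) = D0"
        using top(1) j unfolding zeros_def by (auto simp: K_def)
      thus ?thesis by (simp add: M_def)
    qed
  qed
  moreover have "free ((T_S ^^ t) x) (M - (int K - 1)) \<longleftrightarrow> t = 3 * P - 1" if "t < 3 * P" for t
  proof (cases "t < 2 * P")
    case True
    have "\<not> free ((T_S ^^ t) x) (M - (int K - 1))"
    \<comment> \<open>For \<open>K = 1\<close> the left block is empty and the observed cell is
      \<open>M\<close> itself.\<close>
    proof (cases "K = 1")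
      case True
      thus ?thesis using blocked \<open>t < 2 * P\<close> by simp
    next
      case False
      hence "digit ((T_S ^^ t) x) (M - (int K - 1)) = D0"
        using zeroM[of t] \<open>t < 2 * P\<close> K unfolding zeros_def by auto
      thus ?thesis by (simp add: free_def)
    qed
    with True P show ?thesis by auto
  next
    case False
    hence "(T_S ^^ t) x = (T_S ^^ (t - 2 * P)) z"
      by (simp add: z_iter)
    thus ?thesis using top(2)[of "t - 2 * P"] that False by auto
  qed
  moreover have "M - (int K - 1) = R - (2 ^ Suc i - 1)"
    by (simp add: M_def K_def)
  ultimately show ?case
    unfolding end_iter by (simp add: P_def)
qed

text \<open>A blank stays free and a full period restores the zeros, so \<open>odometer\<close> can
  be restarted at every multiple of \<open>3 ^ i\<close>.\<close>

lemma odometer_periodic: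
  assumes "digit x R = Blank1" "zeros x R (2 ^ i)"
  shows "free ((T_S ^^ t) x) (R - (2 ^ i - 1)) \<longleftrightarrow> t mod 3 ^ i = 3 ^ i - 1"
proof -
  have "zeros ((T_S ^^ (q * 3 ^ i)) x) R (2 ^ i)" for q
  proof (induction q)
    case 0
    show ?case using assms by simp
  next
    case (Suc q)
    thus ?case
      using odometer[OF _ Suc.IH] assms(1)
      by (simp add: free_def funpow_add)
  qed
  from odometer[OF _ this[of "t div 3 ^ i"]] assms(1)
  have "free ((T_S ^^ (t mod 3 ^ i)) ((T_S ^^ (t div 3 ^ i * 3 ^ i)) x)) (R - (2 ^ i - 1))
      \<longleftrightarrow> t mod 3 ^ i = 3 ^ i - 1"
    by (simp add: free_def)
  moreover have "(T_S ^^ (t mod 3 ^ i)) ((T_S ^^ (t div 3 ^ i * 3 ^ i)) x) = (T_S ^^ t) x"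
    by (metis comp_apply funpow_add mod_div_mult_eq)
  ultimately show ?thesis by simp
qed


section \<open>Failure of diam-mean sensitivity\<close>

text \<open>The blank at \<open>n + 2 ^ i\<close> drives the zeros, whose leftmost cell
  \<open>n + 1\<close> is the gate beside the window \<open>[-n, n]\<close>. As \<tau> fixes
  \<open>SymA\<close>, arrows do not affect the symbols there.\<close>

definition shielded :: "nat \<Rightarrow> nat \<Rightarrow> AS config" where
  "shielded n i = Config (\<lambda>j.
     ((if int n < j \<and> j < int n + 2 ^ i then D0 else Blank1, Blank2), SymA))"

text \<open>The ball fixes all cells up to the driving blank. An arrow enters at \<open>n\<close>
  only after a step that starts at residue -1, then crosses one blank per step. So it can be at
  \<open>n - k\<close> only at times congruent to \<open>k\<close> modulo
  \<open>3 ^ i\<close>.\<close>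

lemma shielded_window:
  assumes x: "x \<in> ball (shielded n i) ((1/2) ^ (n + 2 ^ i))"
    and t: "2 * n < t mod 3 ^ i" and j: "\<bar>j\<bar> \<le> int n"
  shows "cell ((T_S ^^ t) x) j = ((Blank1, Blank2), SymA)"
proof -
  have cell: "cell x l = cell (shielded n i) l" if "\<bar>l\<bar> \<le> int n + 2 ^ i" for l
    using x that unfolding mem_ball_config by simp
  have window: "digit x l = Blank1" "\<not> arrow x l" "symbol x l = SymA" if "\<bar>l\<bar> \<le> int n" for l
    using cell[OF add_increasing2[OF _ that]] that
    by (auto simp: digit_def arrow_def symbol_def shielded_def abs_le_iff)
  have "digit x (int n + 2 ^ i) = Blank1"
    using cell[of "int n + 2 ^ i"] by (simp add: digit_def shielded_def)
  moreover have "digit x (int n + 2 ^ i - l) = D0" if "1 \<le> l" "l < 2 ^ i" for l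
    using cell[of "int n + 2 ^ i - l"] that by (simp add: digit_def shielded_def)
  hence "zeros x (int n + 2 ^ i) (2 ^ i)"
    by (simp add: zeros_def)
  ultimately have gate: "free ((T_S ^^ t) x) (int n + 1) \<longleftrightarrow> t mod 3 ^ i = 3 ^ i - 1" for t
    using odometer_periodic[of x "int n + 2 ^ i" i t] by simp
  have phase: "t mod 3 ^ i = k mod 3 ^ i"
    if "arrow ((T_S ^^ t) x) (int n - int k)" "k \<le> 2 * n" for t k
    using that
  proof (induction t arbitrary: k)
    case 0
    thus ?case using window[of "int n - int k"] by simp
  next
    case (Suc t)
    have "free ((T_S ^^ t) x) (int n - int k)"
      using window Suc.prems by (intro free_Blank1) auto
    hence *: "arrow ((T_S ^^ t) x) (int n - int k + 1)" "free ((T_S ^^ t) x) (int n - int k + 1)"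
      using Suc.prems by (auto simp: arrow_T_S)
    show ?case
    proof (cases k)
      case 0
      with * gate[of t] have "t mod 3 ^ i = 3 ^ i - 1"
        by (simp add: algebra_simps)
      thus ?thesis using 0 by (simp add: mod_Suc)
    next
      case (Suc k')
      with * Suc.IH[of k'] Suc.prems have "t mod 3 ^ i = k' mod 3 ^ i"
        by (simp add: algebra_simps)
      thus ?thesis using Suc by (simp add: mod_Suc)
    qed
  qed
  obtain k where k: "j = int n - int k"
    using j by (metis abs_le_D1 diff_diff_eq2 add_diff_cancel_left' zle_iff_zadd add.commute)
  hence "k \<le> 2 * n"
    using j by linarith
  hence "k mod 3 ^ i < t mod 3 ^ i"
    using t by (meson le_less_trans mod_less_eq_dividend)
  hence "\<not> arrow ((T_S ^^ t) x) j"
    using phase[of t k] k \<open>k \<le> 2 * n\<close> by auto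
  hence "snd (fst (cell ((T_S ^^ t) x) j)) = Blank2"
    by (cases "snd (fst (cell ((T_S ^^ t) x) j))") (auto simp: arrow_def)
  moreover have "symbol ((T_S ^^ t) x) j = SymA" for t
    by (induction t) (simp_all add: window j symbol_T_S)
  moreover have "digit ((T_S ^^ t) x) j = Blank1"
    using window j by simp
  ultimately show ?thesis
    by (simp add: prod_eq_iff digit_def symbol_def)
qed

section \<open>Averaging the diameters\<close>

lemma card_small_residues:
  "card {t \<in> {1..N}. t mod P < w} \<le> w * (N div P + 1)" for N P w :: nat
proof -
  have "{t \<in> {1..N}. t mod P < w} \<subseteq> (\<lambda>(r, q). r + q * P) ` ({..<w} \<times> {..N div P})"
  proof
    fix t assume "t \<in> {t \<in> {1..N}. t mod P < w}"
    thus "t \<in> (\<lambda>(r, q). r + q * P) ` ({..<w} \<times> {..N div P})"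
      by (intro image_eqI[of _ _ "(t mod P, t div P)"]) (auto intro: div_le_mono)
  qed
  hence "card {t \<in> {1..N}. t mod P < w} \<le> card ({..<w} \<times> {..N div P})"
    by (intro surj_card_le) auto
  thus ?thesis by (simp add: card_cartesian_product)
qed

text \<open>At residues above \<open>2 * n\<close> the images agree on the window; at the few others
  the trivial bound 1 is used.\<close>

lemma shielded_mean:
  defines "U \<equiv> \<lambda>n i. ball (shielded n i) ((1/2) ^ (n + 2 ^ i))"
  shows "(\<Sum>t=1..N. diameter ((T_S ^^ t) ` U n i))
    \<le> real N * (1/2) ^ n + real (2 * n + 1) * (real N / 3 ^ i + 1)"
proof -
  let ?bad = "{t \<in> {1..N}. t mod 3 ^ i < 2 * n + 1}"
  have "diameter ((T_S ^^ t) ` U n i) \<le> (1/2) ^ n + of_bool (t mod 3 ^ i < 2 * n + 1)" for t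
  proof (rule diameter_config_le)
    fix p q assume pq: "p \<in> (T_S ^^ t) ` U n i" "q \<in> (T_S ^^ t) ` U n i"
    show "dist p q \<le> (1/2) ^ n + of_bool (t mod 3 ^ i < 2 * n + 1)"
    proof (cases "t mod 3 ^ i < 2 * n + 1")
      case True
      thus ?thesis
        using dist_config_le_1[of p q] by (simp add: add_increasing)
    next
      case False
      hence "dist p q < (1/2) ^ n"
        using pq shielded_window[of _ n i t]
        by (auto simp: dist_config_less_iff U_def simp del: funpow.simps)
      thus ?thesis by simp
    qed
  qed simp
  hence "(\<Sum>t=1..N. diameter ((T_S ^^ t) ` U n i))
      \<le> (\<Sum>t=1..N. (1/2) ^ n + of_bool (t mod 3 ^ i < 2 * n + 1))"
    by (rule sum_mono)
  also have "\<dots> = real N * (1/2) ^ n + real (card ?bad)"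
    by (simp add: sum.distrib of_bool_def flip: sum.inter_filter)
  also have "real (card ?bad) \<le> real ((2 * n + 1) * (N div 3 ^ i + 1))"
    using card_small_residues[of N "3 ^ i" "2 * n + 1"] by (simp only: of_nat_le_iff)
  also have "\<dots> = real (2 * n + 1) * (real (N div 3 ^ i) + 1)"
    by (simp only: of_nat_mult of_nat_add of_nat_1)
  also have "\<dots> \<le> real (2 * n + 1) * (real N / 3 ^ i + 1)"
    using of_nat_div_le_of_nat[of N "3 ^ i", where 'a = real]
    by (intro mult_left_mono add_right_mono) auto
  finally show ?thesis by simp
qed

lemma not_diam_mean_sensitive_T_S: "\<not> diam_mean_sensitive T_S"
proof
  assume "diam_mean_sensitive T_S"
  then obtain \<epsilon> where \<epsilon>: "\<epsilon> > 0" and sens: "\<And>U. open U \<Longrightarrow> U \<noteq> {} \<Longrightarrow>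
      limsup (\<lambda>n. ereal ((\<Sum>i=1..n. diameter ((T_S ^^ i) ` U)) / real n)) > ereal \<epsilon>"
    unfolding diam_mean_sensitive_def by blast
  \<comment> \<open>One third of \<epsilon> each goes to the window term, to the density of bad
    times and to the constant term. The width \<open>w\<close> depends on \<open>n\<close>, so
    \<open>i\<close> comes second.\<close>
  obtain n where n: "(1/2 :: real) ^ n < \<epsilon> / 3"
    using real_arch_pow_inv[of "\<epsilon> / 3" "1/2"] \<epsilon> by auto
  define w where "w = real (2 * n + 1)"
  have w: "w > 0" by (simp add: w_def)
  obtain i where "(1/3 :: real) ^ i < \<epsilon> / (3 * w)"
    using real_arch_pow_inv[of "\<epsilon> / (3 * w)" "1/3"] \<epsilon> w by auto
  hence i: "w / 3 ^ i < \<epsilon> / 3"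
    using w by (simp add: field_simps)
  define U where "U = ball (shielded n i) ((1/2) ^ (n + 2 ^ i))"
  have "(\<Sum>t=1..N. diameter ((T_S ^^ t) ` U)) / real N \<le> \<epsilon>" if "N \<ge> nat \<lceil>3 * w / \<epsilon>\<rceil> + 1" for N
  proof -
    have N: "real N > 0" "3 * w / \<epsilon> \<le> real N"
      using that by linarith+
    hence "w \<le> real N * (\<epsilon> / 3)"
      using \<epsilon> by (simp add: field_simps)
    moreover have "real N * (1/2) ^ n \<le> real N * (\<epsilon> / 3)" "real N * (w / 3 ^ i) \<le> real N * (\<epsilon> / 3)"
      using n i N by (intro mult_left_mono; simp)+
    moreover have "w * (real N / 3 ^ i + 1) = real N * (w / 3 ^ i) + w"
      by (simp add: field_simps)
    ultimately have "real N * (1/2) ^ n + w * (real N / 3 ^ i + 1) \<le> real N * \<epsilon>"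
      by argo
    with shielded_mean[where N = N and n = n and i = i]
    have "(\<Sum>t=1..N. diameter ((T_S ^^ t) ` U)) \<le> real N * \<epsilon>"
      unfolding U_def w_def by linarith
    thus ?thesis using N by (simp add: divide_le_eq mult.commute)
  qed
  hence "limsup (\<lambda>N. ereal ((\<Sum>t=1..N. diameter ((T_S ^^ t) ` U)) / real N)) \<le> ereal \<epsilon>"
    by (intro Limsup_bounded eventually_sequentiallyI) simp
  moreover have "open U" "shielded n i \<in> U"
    by (simp_all add: U_def)
  ultimately show False
    using sens[of U] by (auto dest: leD)
qed


section \<open>Failure of almost diam-mean equicontinuity\<close>

text \<open>Induction leftwards from the blank half-line: a digit that avoids 2 forever can advance
  at most once, yet its right neighbour is free infinitely often.\<close>

lemma free_recurrent:
  assumes blank: "\<And>i. i > N \<Longrightarrow> digit x i = Blank1"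
  shows "\<exists>s\<ge>t. free ((T_S ^^ s) x) j"
proof (cases "j > N")
  case True
  hence "free ((T_S ^^ t) x) j"
    by (intro free_Blank1 blank)
  thus ?thesis by blast
next
  case False
  hence "j \<le> N + 1" by simp
  thus ?thesis
  proof (induction j arbitrary: t rule: int_le_induct)
    case base
    have "free ((T_S ^^ t) x) (N + 1)"
      by (intro free_Blank1 blank) simp
    thus ?case by blast
  next
    case (step j)
    show ?case
    proof (rule ccontr)
      assume "\<not> ?case"
      hence stuck: "digit ((T_S ^^ s) x) (j - 1) \<in> {D0, D1}" if "s \<ge> t" for s
        using that by (cases "digit ((T_S ^^ s) x) (j - 1)") (auto simp: free_def)
      have "digit ((T_S ^^ t) x) (j - 1) \<noteq> Blank1"
        using stuck[of t] by (auto simp del: digit_Blank1_iff)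
      hence nonblank: "digit x (j - 1) \<noteq> Blank1"
        by simp
      obtain s where s: "s \<ge> t" "free ((T_S ^^ s) x) j"
        using step.IH by blast
      \<comment> \<open>The first advance must give 1, and any later one would give 2.\<close>
      have D1: "digit ((T_S ^^ (Suc s + r)) x) (j - 1) = D1" for r
      proof (induction r)
        case 0
        show ?case
          using stuck[of s] stuck[of "Suc s"] s nonblank by (auto simp: digit_T_S)
      next
        case (Suc r)
        thus ?case
          using stuck[of "Suc s + Suc r"] s nonblank by (auto simp: digit_T_S split: if_splits)
      qed
      obtain s' where "s' \<ge> Suc s" "free ((T_S ^^ s') x) j"
        using step.IH by blast
      hence "digit ((T_S ^^ Suc s') x) (j - 1) = D2"
        using D1[of "s' - Suc s"] nonblank by (simp add: digit_T_S)
      with stuck[of "Suc s'"] s \<open>s' \<ge> Suc s\<close> show False by auto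
    qed
  qed
qed

text \<open>Induction leftwards: once no arrow remains on \<open>[j, \<infinity>)\<close>, cell
  \<open>j - 1\<close> receives none, and its own arrow leaves as soon as the cell is free.\<close>

lemma arrows_leave:
  assumes blank: "\<And>i. i > N \<Longrightarrow> digit x i = Blank1" and noarr: "\<And>i. i > N \<Longrightarrow> \<not> arrow x i"
  shows "\<exists>t. \<forall>s\<ge>t. \<forall>i\<ge>j. \<not> arrow ((T_S ^^ s) x) i"
proof -
  have far: "\<not> arrow ((T_S ^^ s) x) i" if "i > N" for s i
    using that by (induction s arbitrary: i) (auto simp: noarr arrow_T_S)
  show ?thesis
  proof (cases "j > N")
    case True
    thus ?thesis using far by fastforce
  next
    case False
    hence "j \<le> N + 1" by simp
    thus ?thesis
    proof (induction j rule: int_le_induct)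
      case base
      thus ?case using far by fastforce
    next
      case (step j)
      then obtain t where t: "\<And>s i. s \<ge> t \<Longrightarrow> i \<ge> j \<Longrightarrow> \<not> arrow ((T_S ^^ s) x) i"
        by blast
      obtain s where s: "s \<ge> t" "free ((T_S ^^ s) x) (j - 1)"
        using free_recurrent[OF blank] by blast
      have "\<not> arrow ((T_S ^^ (Suc s + r)) x) (j - 1)" for r
        by (induction r) (use s t in \<open>auto simp: arrow_T_S\<close>)
      hence "\<not> arrow ((T_S ^^ r) x) (j - 1)" if "r \<ge> Suc s" for r
        using that by (metis le_add_diff_inverse)
      hence "\<not> arrow ((T_S ^^ r) x) i" if "r \<ge> Suc s" "i \<ge> j - 1" for r i
        using t[of r i] that s by (cases "i = j - 1") auto
      thus ?case by blast
    qed
  qed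
qed

section \<open>The trajectory of an additional arrow\<close>

definition add_arrow :: "AS config \<Rightarrow> int \<Rightarrow> AS config" where
  "add_arrow x M = Config (\<lambda>i.
     ((digit x i, if i = M \<or> arrow x i then Arrow else Blank2), symbol x i))"

lemma add_arrow_simps [simp]:
  "digit (add_arrow x M) i = digit x i"
  "arrow (add_arrow x M) i \<longleftrightarrow> i = M \<or> arrow x i"
  "symbol (add_arrow x M) i = symbol x i"
  by (simp_all add: add_arrow_def digit_def arrow_def symbol_def)

lemma digit_add_arrow [simp]: "digit ((T_S ^^ t) (add_arrow x M)) i = digit ((T_S ^^ t) x) i"
  by (induction t arbitrary: i) (simp_all add: digit_T_S free_def)

lemma free_add_arrow [simp]: "free ((T_S ^^ t) (add_arrow x M)) i \<longleftrightarrow> free ((T_S ^^ t) x) i"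
  by (simp add: free_def)

text \<open>The position of the arrow started at \<open>M\<close>. The orbit of \<open>x\<close>
  itself suffices, since adding the arrow leaves the free cells unchanged.\<close>

primrec walk :: "AS config \<Rightarrow> int \<Rightarrow> nat \<Rightarrow> int" where
  "walk x M 0 = M"
| "walk x M (Suc t) = (if free ((T_S ^^ t) x) (walk x M t) then walk x M t - 1 else walk x M t)"

text \<open>The digits ignore the arrows, and the arrows ignore each other until they merge.\<close>

lemma arrow_add_arrow:
  "arrow ((T_S ^^ t) (add_arrow x M)) i \<longleftrightarrow> i = walk x M t \<or> arrow ((T_S ^^ t) x) i"
proof (induction t arbitrary: i)
  case (Suc t)
  have "i + 1 = w \<longleftrightarrow> i = w - 1" for w :: int
    by linarith
  thus ?case
    by (cases "free ((T_S ^^ t) x) (walk x M t)") (auto simp: arrow_T_S Suc.IH)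
qed simp

lemma walk_antimono: "s \<le> t \<Longrightarrow> walk x M t \<le> walk x M s"
  by (rule lift_Suc_antimono_le[of "walk x M"]) auto

lemma walk_ge: "walk x M t \<ge> M - int t"
  by (induction t) auto

text \<open>By \<open>free_recurrent\<close> the walk never stalls, and with unit steps it skips no
  cell.\<close>

lemma walk_reaches:
  assumes "\<And>i. i > N \<Longrightarrow> digit x i = Blank1" "j \<le> M"
  shows "\<exists>t. walk x M t = j"
  using assms(2)
proof (induction j rule: int_le_induct)
  case base
  show ?case by (rule exI[of _ 0]) simp
next
  case (step j)
  then obtain t where t: "walk x M t = j" by blast
  show ?case
  proof (rule ccontr)
    assume no: "\<not> ?case"
    have stay: "walk x M (t + r) = j" for r
    proof (induction r)
      case (Suc r)
      thus ?case using no walk.simps(2)[of x M "t + r"] by (metis add_Suc_right)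
    qed (simp add: t)
    obtain s where "s \<ge> t" "free ((T_S ^^ s) x) j"
      using free_recurrent[OF assms(1)] by blast
    with stay[of "s - t"] have "walk x M (Suc s) = j - 1" by simp
    with no show False by blast
  qed
qed

text \<open>A blank is always free, so the walk leaves it after one step and never returns.\<close>

lemma walk_at_blank:
  assumes "digit x i = Blank1" "walk x M t = i"
  shows "walk x M s = i \<longleftrightarrow> s = t"
proof -
  have next_step: "walk x M s' < i" if "walk x M s = i" "s < s'" for s s'
    using walk_antimono[of "Suc s" s' x M] that free_Blank1[OF assms(1), of s] by simp
  show ?thesis
    using next_step[of s t] next_step[of t s] assms(2) by (cases s t rule: linorder_cases) auto
qed

lemma tau_invol [simp]: "\<tau> (\<tau> a) = a"
  by (cases a) simp_all

text \<open>The additional arrow suppresses exactly one application of \<tau>. As \<tau> is an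
  involution, the symbols then differ by one \<tau> for good.\<close>

lemma symbol_swapped:
  assumes "digit x 0 = Blank1" "walk x M t = 0" "\<not> arrow ((T_S ^^ t) x) 0"
  shows "symbol ((T_S ^^ s) (add_arrow x M)) 0 =
    (if s \<le> t then symbol ((T_S ^^ s) x) 0 else \<tau> (symbol ((T_S ^^ s) x) 0))"
proof (induction s)
  case (Suc s)
  have "arrow ((T_S ^^ s) (add_arrow x M)) 0 \<longleftrightarrow> s = t \<or> arrow ((T_S ^^ s) x) 0"
    using walk_at_blank[OF assms(1,2), of s] by (auto simp: arrow_add_arrow)
  thus ?case
    using Suc assms(3) by (cases "s = t") (simp_all add: symbol_T_S)
qed simp

lemma not_equicontinuity_point:
  assumes "digit x 0 = Blank1" "symbol x 0 = SymB"
  shows "\<not> diam_mean_equicontinuity_point T_S x"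
proof
  assume "diam_mean_equicontinuity_point T_S x"
  from this[unfolded diam_mean_equicontinuity_point_def, rule_format, of "1/2"] obtain \<delta> where \<delta>: "\<delta> > 0" and
    lim: "limsup (\<lambda>n. ereal ((\<Sum>i=0..n. diameter ((T_S ^^ i) ` ball x \<delta>)) / (real n + 1))) < ereal (1/2)"
    using half_gt_zero[OF zero_less_one] by blast
  obtain N where N: "(1/2) ^ N < \<delta>"
    using real_arch_pow_inv[of \<delta> "1/2"] \<delta> by auto
  define y where
    "y = Config (\<lambda>i. if \<bar>i\<bar> \<le> int N then cell x i else ((Blank1, Blank2), SymA))"
  have blank: "digit y i = Blank1" "\<not> arrow y i" if "i > int N" for i
    using that by (simp_all add: y_def digit_def arrow_def)
  have y0: "digit y 0 = Blank1" "symbol y 0 = SymB"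
    using assms by (simp_all add: y_def digit_def symbol_def)
  obtain t where t: "\<And>s i. s \<ge> t \<Longrightarrow> i \<ge> 0 \<Longrightarrow> \<not> arrow ((T_S ^^ s) y) i"
    using arrows_leave[of "int N" y 0] blank by blast
  \<comment> \<open>Beyond \<open>N\<close> the new arrow stays within the ball. At speed at most 1
    it needs at least \<open>M > t\<close> steps to the origin, by which time the other arrows have
    left.\<close>
  define M where "M = int N + int t + 1"
  obtain u where u: "walk y M u = 0"
    using walk_reaches[of "int N" y 0 M] blank by (auto simp: M_def)
  have "u \<ge> t"
    using walk_ge[of M u y] u by (simp add: M_def)
  hence swapped: "symbol ((T_S ^^ s) (add_arrow y M)) 0 = \<tau> (symbol ((T_S ^^ s) y) 0)" if "s > u" for s
    using symbol_swapped[OF y0(1) u t] that by simp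
  \<comment> \<open>Starting from \<open>SymB\<close> the symbol stays in the 2-cycle of \<tau>, so
    the swap is a real difference.\<close>
  have not_A: "symbol ((T_S ^^ s) y) 0 \<noteq> SymA" for s
  proof (induction s)
    case (Suc s)
    thus ?case by (cases "symbol ((T_S ^^ s) y) 0") (auto simp: symbol_T_S)
  qed (simp add: y0)
  have mem: "y \<in> ball x \<delta>" "add_arrow y M \<in> ball x \<delta>"
  proof -
    have y_x: "cell y j = cell x j" if "\<bar>j\<bar> \<le> int N" for j
      using that by (simp add: y_def)
    moreover have "cell (add_arrow y M) j = cell y j" if "\<bar>j\<bar> \<le> int N" for j
      using that by (intro cell_eqI) (auto simp: M_def)
    ultimately have "y \<in> ball x ((1/2) ^ N)" "add_arrow y M \<in> ball x ((1/2) ^ N)"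
      unfolding mem_ball_config by simp_all
    moreover have "ball x ((1/2) ^ N) \<subseteq> ball x \<delta>"
      using N by (intro subset_ball) simp
    ultimately show "y \<in> ball x \<delta>" "add_arrow y M \<in> ball x \<delta>"
      by blast+
  qed
  have diam: "diameter ((T_S ^^ s) ` ball x \<delta>) \<ge> of_bool (s > u)" for s
  proof (cases "s > u")
    case True
    have "cell ((T_S ^^ s) y) 0 \<noteq> cell ((T_S ^^ s) (add_arrow y M)) 0"
      using swapped[OF True] not_A[of s]
      by (cases "symbol ((T_S ^^ s) y) 0") (auto simp: symbol_def)
    hence "\<not> dist ((T_S ^^ s) y) ((T_S ^^ s) (add_arrow y M)) < (1/2) ^ 0"
      unfolding dist_config_less_iff by auto
    thus ?thesis
      using True dist_le_diameter_config[OF imageI[OF mem(1)] imageI[OF mem(2)], of "T_S ^^ s"]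
      by simp
  qed (simp add: diameter_ge_0[OF bounded_config])
  \<comment> \<open>The last \<open>n - u\<close> of the \<open>n + 1\<close> diameters are at least
    1, and \<open>(n - u) / (n + 1)\<close> reaches 1/2 exactly from \<open>n = 2 * u + 1\<close>
    on.\<close>
  have "1/2 \<le> (\<Sum>s=0..n. diameter ((T_S ^^ s) ` ball x \<delta>)) / (real n + 1)" if "n \<ge> 2 * u + 1" for n
  proof -
    have "real n - real u = real (card {u<..n})"
      using that by simp
    also have "{u<..n} = {s \<in> {0..n}. s > u}"
      by auto
    also have "real (card \<dots>) = (\<Sum>s=0..n. of_bool (s > u))"
      by (simp add: of_bool_def flip: sum.inter_filter)
    also have "\<dots> \<le> (\<Sum>s=0..n. diameter ((T_S ^^ s) ` ball x \<delta>))"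
      by (intro sum_mono diam)
    finally show ?thesis
      using that by (simp add: le_divide_eq)
  qed
  hence "ereal (1/2) \<le> limsup (\<lambda>n. ereal ((\<Sum>s=0..n. diameter ((T_S ^^ s) ` ball x \<delta>)) / (real n + 1)))"
    by (intro le_Limsup eventually_sequentiallyI) simp_all
  with lim show False by simp
qed

theorem theorem4p5:
  shows "\<not> diam_mean_sensitive T_S \<and> \<not> almost_diam_mean_equicontinuous T_S"
proof
  show "\<not> almost_diam_mean_equicontinuous T_S"
  proof
    \<comment> \<open>The ball of radius 1 around \<open>c\<close> prescribes just the cell at the
      origin.\<close>
    define c :: "AS config" where "c = Config (\<lambda>_. ((Blank1, Blank2), SymB))"
    assume "almost_diam_mean_equicontinuous T_S"
    hence "{x. diam_mean_equicontinuity_point T_S x} \<inter> ball c ((1/2) ^ 0) \<noteq> {}"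
      unfolding almost_diam_mean_equicontinuous_def by (rule residual_dense) simp_all
    then obtain x where x: "diam_mean_equicontinuity_point T_S x" "x \<in> ball c ((1/2) ^ 0)"
      by blast
    hence "cell x 0 = ((Blank1, Blank2), SymB)"
      unfolding mem_ball_config by (simp add: c_def)
    with x not_equicontinuity_point[of x] show False
      by (simp add: digit_def symbol_def)
  qed
qed (rule not_diam_mean_sensitive_T_S)

end
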